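(* Let $G$ be a finite abelian group. If $f\in(\mathbb{C}^{o(G)})^*$ and $\tau\in\mathbb{C}^{o(G)}$ are such that $f(\tau)\neq0$, then $$x=\frac{1}{o(G)f(\tau)}\sum_{\lambda\in G\times\widehat{G}}f(\pi(\lambda)^{-1}x)\,\pi(\lambda)\tau,\quad\forall x\in\mathbb{C}^{o(G)}.$$ In other words, $(\{f(\pi(\lambda)^{-1})\}_{\lambda\in G\times\widehat{G}},\{\pi(\lambda)\tau\}_{\lambda\in G\times\widehat{G}})$ is a Gabor-Schauder frame for $\mathbb{C}^{o(G)}$.
   Context: $G$ is a finite abelian group (written additively), $o(G)$ is its order, and $\widehat{G}$ is its group of characters. $\mathbb{C}^{o(G)}$ is the space of vectors $(x_g)_{g\in G}$ and $(\mathbb{C}^{o(G)})^*$ is the space of linear functionals on it. For $\lambda=(k,\xi)\in G\times\widehat{G}$ the time-frequency shift operator $\pi(\lambda):\mathbb{C}^{o(G)}\to\mathbb{C}^{o(G)}$ is $\pi(\lambda)(x_g)_{g\in G}=(\xi(g)x_{g-k})_{g\in G}$; it is invertible. For a subgroup $\Lambda\subseteq G\times\widehat{G}$, a nonzero $f\in(\mathbb{C}^{o(G)})^*$ and a nonzero $\tau\in\mathbb{C}^{o(G)}$, the pair $(\{f(\pi(\lambda)^{-1})\}_{\lambda\in\Lambda},\{\pi(\lambda)\tau\}_{\lambda\in\Lambda})$, where $f(\pi(\lambda)^{-1})$ denotes the functional $x\mapsto f(\pi(\lambda)^{-1}x)$, is called a Gabor-Schauder frame for $\mathbb{C}^{o(G)}$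 if the operator $S_{f,\tau,\Lambda}:\mathbb{C}^{o(G)}\to\mathbb{C}^{o(G)}$, $S_{f,\tau,\Lambda}x=\sum_{\lambda\in\Lambda}f(\pi(\lambda)^{-1}x)\pi(\lambda)\tau$, is invertible. *)

theory Defs
  imports "HOL-Analysis.Analysis" "HOL-Algebra.Group"
begin

text \<open>
  The finite abelian group is the universe of a type \<open>'g\<close> of sorts \<open>finite\<close> and
  \<open>ab_group_add\<close>; its order is \<open>CARD('g)\<close>, and the vectors indexed by the group form the
  type \<open>complex ^ 'g\<close>, a complex vector space under \<open>*s\<close>.
\<close>

definition characters :: "('g::ab_group_add \<Rightarrow> complex) set" where
  "characters = {\<xi>. (\<forall>g. norm (\<xi> g) = 1) \<and> (\<forall>g h. \<xi> (g + h) = \<xi> g * \<xi> h)}"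

definition dual_group :: "('g::ab_group_add \<Rightarrow> complex) monoid" where
  "dual_group = \<lparr>carrier = characters, mult = (\<lambda>\<xi> \<eta> g. \<xi> g * \<eta> g), one = (\<lambda>g. 1)\<rparr>"

definition add_group :: "'g::ab_group_add monoid" where
  "add_group = \<lparr>carrier = UNIV, mult = (+), one = 0\<rparr>"

definition phase_space :: "('g::ab_group_add \<times> ('g \<Rightarrow> complex)) monoid" where
  "phase_space = add_group \<times>\<times> dual_group"

fun tf_shift :: "'g::{finite,ab_group_add} \<times> ('g \<Rightarrow> complex) \<Rightarrow> complex ^ 'g::{finite,ab_group_add} \<Rightarrow> complex ^ 'g::{finite,ab_group_add}" where
  "tf_shift (k, \<xi>) x = (\<chi> g. \<xi> g * x $ (g - k))"

definition gabor_operator ::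
  "(complex ^ 'g::{finite,ab_group_add} \<Rightarrow> complex) \<Rightarrow> complex ^ 'g::{finite,ab_group_add} \<Rightarrow> ('g \<times> ('g \<Rightarrow> complex)) set
    \<Rightarrow> complex ^ 'g::{finite,ab_group_add} \<Rightarrow> complex ^ 'g::{finite,ab_group_add}" where
  "gabor_operator f \<tau> \<Lambda> x = (\<Sum>\<mu>\<in>\<Lambda>. f (inv_into UNIV (tf_shift \<mu>) x) *s tf_shift \<mu> \<tau>)"

definition invertible_operator :: "(complex ^ 'n \<Rightarrow> complex ^ 'n) \<Rightarrow> bool" where
  "invertible_operator S \<longleftrightarrow> Vector_Spaces.linear (*s) (*s) S \<and>
     (\<exists>T. Vector_Spaces.linear (*s) (*s) T \<and> T \<circ> S = id \<and> S \<circ> T = id)"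

text \<open>The pair of families is determined by \<open>f\<close>, \<open>\<tau>\<close> and \<open>\<Lambda>\<close>, which are the arguments.\<close>

definition gabor_schauder_frame ::
  "(complex ^ 'g::{finite,ab_group_add} \<Rightarrow> complex) \<Rightarrow> complex ^ 'g::{finite,ab_group_add} \<Rightarrow> ('g \<times> ('g \<Rightarrow> complex)) set
    \<Rightarrow> bool" where
  "gabor_schauder_frame f \<tau> \<Lambda> \<longleftrightarrow>
     subgroup \<Lambda> phase_space \<and>
     Vector_Spaces.linear (*s) (*) f \<and> f \<noteq> (\<lambda>x. 0) \<and> \<tau> \<noteq> 0 \<and>
     invertible_operator (gabor_operator f \<tau> \<Lambda>)"

lemma carrier_phase_space: "carrier phase_space = UNIV \<times> characters"
  by (simp add: phase_space_def add_group_def dual_group_def)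

lemma character_zero:
  assumes "\<xi> \<in> characters" shows "\<xi> 0 = 1"
proof -
  have "\<xi> (0 + 0) = \<xi> 0 * \<xi> 0" "norm (\<xi> 0) = 1"
    using assms unfolding characters_def by blast+
  then show ?thesis by (metis add.right_neutral mult_cancel_left1 norm_zero zero_neq_one)
qed

lemma character_nonzero: "\<xi> \<in> characters \<Longrightarrow> \<xi> g \<noteq> 0"
  by (auto simp: characters_def dest: spec[of _ g])

lemma comm_group_dual_group: "comm_group (dual_group :: ('g::ab_group_add \<Rightarrow> complex) monoid)"
proof (rule comm_groupI)
  fix \<xi> :: "'g \<Rightarrow> complex" assume x: "\<xi> \<in> carrier dual_group"
  then have c: "\<xi> \<in> characters" by (simp add: dual_group_def)
  have n0: "\<xi> g \<noteq> 0" for g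
    using c by (rule character_nonzero)
  have "(\<lambda>g. inverse (\<xi> g)) \<in> carrier dual_group"
    using c by (simp add: dual_group_def characters_def norm_inverse)
  moreover have "(\<lambda>g. inverse (\<xi> g)) \<otimes>\<^bsub>dual_group\<^esub> \<xi> = \<one>\<^bsub>dual_group\<^esub>"
    using n0 by (simp add: dual_group_def)
  ultimately show "\<exists>\<eta>\<in>carrier dual_group. \<eta> \<otimes>\<^bsub>dual_group\<^esub> \<xi> = \<one>\<^bsub>dual_group\<^esub>" by blast
qed (auto simp: dual_group_def characters_def norm_mult algebra_simps)

lemma comm_group_add_group: "comm_group (add_group :: 'g::ab_group_add monoid)"
proof (rule comm_groupI)
  fix x :: 'g
  show "\<exists>y\<in>carrier add_group. y \<otimes>\<^bsub>add_group\<^esub> x = \<one>\<^bsub>add_group\<^esub>"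
    by (rule bexI[of _ "- x"]) (auto simp: add_group_def)
qed (auto simp: add_group_def algebra_simps)

lemma group_phase_space: "group phase_space"
  unfolding phase_space_def
  by (intro DirProd_group comm_group.axioms(2) comm_group_add_group comm_group_dual_group)

lemma finite_characters: "finite (characters :: ('g::{finite,ab_group_add} \<Rightarrow> complex) set)"
proof -
  have "\<xi> g ^ CARD('g) = 1" if "\<xi> \<in> characters" for \<xi> :: "'g \<Rightarrow> complex" and g
  proof -
    have hom: "\<And>g h. \<xi> (g + h) = \<xi> g * \<xi> h" and nz: "\<And>g. \<xi> g \<noteq> 0"
      using that character_nonzero by (auto simp: characters_def)
    have "(\<Prod>h\<in>UNIV. \<xi> h) = (\<Prod>h\<in>UNIV. \<xi> (g + h))"
      by (rule prod.reindex_bij_betw[symmetric]) (rule bij_plus)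
    also have "\<dots> = \<xi> g ^ CARD('g) * (\<Prod>h\<in>UNIV. \<xi> h)"
      by (simp add: hom prod.distrib)
    finally show ?thesis using nz by simp
  qed
  then have "characters \<subseteq> Pi\<^sub>E (UNIV :: 'g set) (\<lambda>_. {z::complex. z ^ CARD('g) = 1})"
    by auto
  then show ?thesis
    by (rule finite_subset) (intro finite_PiE finite finite_roots_unity; simp)
qed

lemma bij_tf_shift:
  assumes "\<xi> \<in> characters" shows "bij (tf_shift (k, \<xi>))"
proof (rule o_bij)
  have nz: "\<xi> g \<noteq> 0" for g using assms by (rule character_nonzero)
  show "(\<lambda>y. \<chi> g. y $ (g + k) / \<xi> (g + k)) \<circ> tf_shift (k, \<xi>) = id"
    by (auto simp: fun_eq_iff vec_eq_iff nz)
  show "tf_shift (k, \<xi>) \<circ> (\<lambda>y. \<chi> g. y $ (g + k) / \<xi> (g + k)) = id"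
    by (auto simp: fun_eq_iff vec_eq_iff nz)
qed

end

theory Submission
  imports Defs
begin

text \<open>
  The proof is coordinatewise. Writing \<open>f y = (\<Sum>h. c h * y $ h)\<close> and
  \<open>(\<pi>(k,\<xi>)\<inverse> x) $ h = x $ (h + k) / \<xi> (h + k)\<close>, the \<open>g\<close>-th coordinate of the frame operator is a
  sum over \<open>k\<close> and \<open>h\<close> of \<open>c h * x $ (h + k) * \<tau> $ (g - k)\<close> weighted by
  \<open>\<Sum>\<xi>. \<xi> (g - (h + k))\<close>. By orthogonality of characters the weight is the order of the group
  when \<open>h + k = g\<close> and zero otherwise, so only \<open>x $ g\<close> survives, with coefficient
  \<open>o(G) * (\<Sum>h. c h * \<tau> $ h) = o(G) * f \<tau>\<close>. The frame operator is thus a nonzero scalar, and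
  both claims follow.

  The substance lies in the orthogonality relation \<open>sum_characters\<close>, which also contains the fact
  that there are as many characters as group elements. It rests on one existence result,
  \<open>characters_separate\<close>: every nonzero \<open>d\<close> admits a character \<open>\<xi>\<close> with \<open>\<xi> d \<noteq> 1\<close>. Such a
  \<open>\<xi>\<close> is built by extending characters from subgroups (\<open>extend_partial_character\<close>). Given
  separation, translating by \<open>\<xi>\<close> in the dual group kills \<open>\<Sum>\<xi>. \<xi> d\<close> for \<open>d \<noteq> 0\<close>, and evaluating
  \<open>\<Sum>g. \<Sum>\<xi>. \<xi> g\<close> in both orders then yields the number of characters.
\<close>

section \<open>Extending characters from subgroups\<close>

primrec nat_multiple :: "nat \<Rightarrow> 'g::ab_group_add \<Rightarrow> 'g" where
  "nat_multiple 0 a = 0"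
| "nat_multiple (Suc n) a = a + nat_multiple n a"

lemma nat_multiple_add: "nat_multiple (m + n) a = nat_multiple m a + nat_multiple n a"
  by (induction m) (auto simp: algebra_simps)

text \<open>
  The ambient groups being finite, closure under addition already makes \<open>H\<close> a subgroup.
\<close>

definition partial_character :: "'g::ab_group_add set \<Rightarrow> ('g \<Rightarrow> complex) \<Rightarrow> bool" where
  "partial_character H \<psi> \<longleftrightarrow> 0 \<in> H \<and>
     (\<forall>x\<in>H. \<forall>y\<in>H. x + y \<in> H \<and> \<psi> (x + y) = \<psi> x * \<psi> y) \<and> (\<forall>x\<in>H. norm (\<psi> x) = 1)"

text \<open>
  Translation by an element of the submonoid is an injective self-map of a finite set, hence
  hits \<open>0\<close>.
\<close>

lemma finite_submonoid_uminus:
  fixes H :: "'g::{finite,ab_group_add} set"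
  assumes "0 \<in> H" and add: "\<And>x y. x \<in> H \<Longrightarrow> y \<in> H \<Longrightarrow> x + y \<in> H" and x: "x \<in> H"
  shows "- x \<in> H"
proof -
  have "(+) x ` H = H"
    by (rule endo_inj_surj) (auto simp: add x)
  with \<open>0 \<in> H\<close> obtain y where "y \<in> H" "x + y = 0" by (metis imageE)
  then show ?thesis by (simp add: add_eq_0_iff)
qed

lemma nat_multiple_eq_zero:
  fixes a :: "'g::{finite,ab_group_add}"
  obtains n where "n > 0" "nat_multiple n a = 0"
proof -
  let ?A = "range (\<lambda>n. nat_multiple n a)"
  have "0 \<in> ?A" by (rule range_eqI[of _ _ 0]) simp
  moreover have "x + y \<in> ?A" if "x \<in> ?A" "y \<in> ?A" for x y
    using that by (auto simp flip: nat_multiple_add)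
  moreover have "a \<in> ?A" by (rule range_eqI[of _ _ 1]) simp
  ultimately have "- a \<in> ?A" by (rule finite_submonoid_uminus)
  then obtain n where "- a = nat_multiple n a" by auto
  then have "nat_multiple (Suc n) a = 0" by (metis nat_multiple.simps(2) right_minus)
  then show thesis using that by blast
qed

lemma partial_character_zero:
  assumes "partial_character H \<psi>"
  shows "\<psi> 0 = 1"
proof -
  have "\<psi> 0 = \<psi> 0 * \<psi> 0" "norm (\<psi> 0) = 1"
    using assms unfolding partial_character_def by (metis add.right_neutral)+
  then show ?thesis by (metis mult_cancel_left1 norm_zero zero_neq_one)
qed

text \<open>
  Let \<open>m\<close> be the order of \<open>a\<close> modulo \<open>H\<close>. A value \<open>w\<close> is admissible at \<open>a\<close> exactly when
  \<open>w ^ m\<close> agrees with the prescribed value at \<open>m a \<in> H\<close>. Since \<open>a \<notin> H\<close> means \<open>m \<ge> 2\<close>, there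
  are at least two such \<open>w\<close>, so \<open>1\<close> can be avoided. This freedom is what makes the same lemma
  serve both to create a character that is nontrivial at a given point and to extend it further.
\<close>

lemma extend_partial_character:
  fixes H :: "'g::{finite,ab_group_add} set"
  assumes pc: "partial_character H \<psi>" and a: "a \<notin> H"
  obtains H' \<psi>' where "partial_character H' \<psi>'" "H \<subseteq> H'" "a \<in> H'"
    "\<And>x. x \<in> H \<Longrightarrow> \<psi>' x = \<psi> x" "\<psi>' a \<noteq> 1"
proof -
  have zero: "0 \<in> H" and add: "\<And>x y. x \<in> H \<Longrightarrow> y \<in> H \<Longrightarrow> x + y \<in> H"
    and hom: "\<And>x y. x \<in> H \<Longrightarrow> y \<in> H \<Longrightarrow> \<psi> (x + y) = \<psi> x * \<psi> y"
    and norm: "\<And>x. x \<in> H \<Longrightarrow> norm (\<psi> x) = 1"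
    using pc by (auto simp: partial_character_def)
  have uminus: "x \<in> H \<Longrightarrow> - x \<in> H" for x
    using finite_submonoid_uminus[OF zero add] by blast
  have diff: "x \<in> H \<Longrightarrow> y \<in> H \<Longrightarrow> x - y \<in> H" for x y
    using add[OF _ uminus] by (metis diff_conv_add_uminus)
  have psi0: "\<psi> 0 = 1" by (rule partial_character_zero[OF pc])
  define m where "m = (LEAST n. n > 0 \<and> nat_multiple n a \<in> H)"
  have "\<exists>n. n > 0 \<and> nat_multiple n a \<in> H"
    using zero nat_multiple_eq_zero[of a] by metis
  then have m: "m > 0" "nat_multiple m a \<in> H"
    unfolding m_def by (metis (mono_tags, lifting) LeastI)+
  have least: "m \<le> n" if "n > 0" "nat_multiple n a \<in> H" for n
    unfolding m_def by (rule Least_le) (use that in auto)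
  have "m \<noteq> 1" using m(2) a by auto
  define c where "c = \<psi> (nat_multiple m a)"
  have c: "norm c = 1" unfolding c_def by (rule norm[OF m(2)])
  have "card {z. z ^ m = c} = m"
    by (rule card_nth_roots) (use c m in auto)
  then have "\<not> {z. z ^ m = c} \<subseteq> {1}"
    using m(1) \<open>m \<noteq> 1\<close> card_mono[of "{1}" "{z. z ^ m = c}"] by auto
  then obtain w where w: "w ^ m = c" "w \<noteq> 1" by auto
  have "norm w ^ m = 1" using c w(1) by (simp flip: norm_power)
  then have norm_w: "norm w = 1"
    using power_eq_imp_eq_base[of "norm w" m 1] m(1) by simp
  \<comment> \<open>Two representations \<open>h + i a = h' + j a\<close> differ by a multiple of \<open>a\<close> lying in \<open>H\<close>, so this
    is what makes the extension well defined. Such multiples are reached by repeatedly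
    removing \<open>m\<close> copies of \<open>a\<close>.\<close>
  have agree: "\<psi> (nat_multiple n a) = w ^ n" if "nat_multiple n a \<in> H" for n
    using that
  proof (induction n rule: less_induct)
    case (less n)
    show ?case
    proof (cases "n = 0")
      case False
      then obtain r where r: "n = m + r" using least less.prems le_Suc_ex by blast
      have "nat_multiple r a = nat_multiple n a - nat_multiple m a"
        by (simp add: r nat_multiple_add)
      then have "nat_multiple r a \<in> H" using diff less.prems m(2) by simp
      then show ?thesis
        using less.IH[of r] m hom w(1) by (simp add: r nat_multiple_add power_add c_def)
    qed (simp add: psi0)
  qed
  have well_defined_le: "\<psi> h * w ^ i = \<psi> h' * w ^ j"
    if hH: "h \<in> H" "h' \<in> H" and eq: "h + nat_multiple i a = h' + nat_multiple j a" and "i \<le> j" for h h' i j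
  proof -
    obtain r where r: "j = i + r" using \<open>i \<le> j\<close> le_Suc_ex by blast
    have h: "h = h' + nat_multiple r a"
      using eq by (simp add: r nat_multiple_add algebra_simps)
    then have "nat_multiple r a = h - h'" by simp
    then have "nat_multiple r a \<in> H" using diff hH by simp
    then show ?thesis using h hH hom agree by (simp add: r power_add)
  qed
  have well_defined: "\<psi> h * w ^ i = \<psi> h' * w ^ j"
    if "h \<in> H" "h' \<in> H" "h + nat_multiple i a = h' + nat_multiple j a" for h h' i j
    using well_defined_le[OF that] well_defined_le[OF that(2,1) that(3)[symmetric]]
    by (metis nat_le_linear)
  define H' where "H' = {h + nat_multiple i a | h i. h \<in> H}"
  define \<psi>' where "\<psi>' x = (THE z. \<exists>h\<in>H. \<exists>i. x = h + nat_multiple i a \<and> z = \<psi> h * w ^ i)" for x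
  have val: "\<psi>' (h + nat_multiple i a) = \<psi> h * w ^ i" if "h \<in> H" for h i
    unfolding \<psi>'_def by (rule the_equality) (use that in \<open>auto dest: well_defined\<close>)
  have "partial_character H' \<psi>'"
    unfolding partial_character_def
  proof (intro conjI ballI)
    show "0 \<in> H'" unfolding H'_def using zero
      by (auto intro!: exI[of _ 0])
  next
    fix x y assume "x \<in> H'" "y \<in> H'"
    then obtain h i k j where h: "h \<in> H" "x = h + nat_multiple i a"
      and k: "k \<in> H" "y = k + nat_multiple j a" by (auto simp: H'_def)
    have xy: "x + y = (h + k) + nat_multiple (i + j) a"
      by (simp add: h k nat_multiple_add algebra_simps)
    then show "x + y \<in> H'" unfolding H'_def using add h k by blast
    show "\<psi>' (x + y) = \<psi>' x * \<psi>' y"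
      unfolding xy val[OF add[OF h(1) k(1)]]
      by (simp add: h(2) k(2) val[OF h(1)] val[OF k(1)] hom[OF h(1) k(1)] power_add mult_ac)
  next
    fix x assume "x \<in> H'"
    then show "norm (\<psi>' x) = 1"
      using val by (auto simp: H'_def norm_mult norm_power norm_w norm)
  qed
  moreover have in_H': "h + nat_multiple i a \<in> H'" if "h \<in> H" for h i
    using that unfolding H'_def by blast
  have "H \<subseteq> H'" using in_H'[of _ 0] by auto
  moreover have "a \<in> H'" using in_H'[OF zero, of 1] by simp
  moreover have "\<psi>' x = \<psi> x" if "x \<in> H" for x using val[OF that, of 0] by simp
  moreover have "\<psi>' a \<noteq> 1" using val[OF zero, of 1] w(2) by (simp add: psi0)
  ultimately show thesis by (rule that)
qed

text \<open>
  Extend the trivial character of the zero subgroup to one that is nontrivial at \<open>d\<close>. Among all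
  partial characters nontrivial at \<open>d\<close>, one with a domain of maximal size is total, since it
  could otherwise be extended again.
\<close>

lemma characters_separate:
  fixes d :: "'g::{finite,ab_group_add}"
  assumes "d \<noteq> 0"
  obtains \<xi> where "\<xi> \<in> characters" "\<xi> d \<noteq> 1"
proof -
  define P where "P = (\<lambda>(H, \<psi>). partial_character H \<psi> \<and> d \<in> H \<and> \<psi> d \<noteq> (1::complex))"
  have "partial_character {0::'g} (\<lambda>_. 1)" by (simp add: partial_character_def)
  moreover have "d \<notin> {0}" using assms by simp
  ultimately obtain H0 \<psi>0 where "partial_character H0 \<psi>0" "d \<in> H0" "\<psi>0 d \<noteq> 1"
    by (rule extend_partial_character)
  then have "P (H0, \<psi>0)" by (simp add: P_def)
  moreover have "\<forall>p. P p \<longrightarrow> card (fst p) < Suc CARD('g)"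
    by (simp add: card_mono less_Suc_eq_le)
  ultimately obtain p where p: "P p" and max: "\<And>q. P q \<Longrightarrow> card (fst q) \<le> card (fst p)"
    using ex_has_greatest_nat[of P "(H0, \<psi>0)" "\<lambda>p. card (fst p)" "Suc CARD('g)"]
    by blast
  obtain H \<psi> where Hx: "p = (H, \<psi>)" by (cases p)
  have H: "partial_character H \<psi>" "d \<in> H" "\<psi> d \<noteq> 1" using p by (auto simp: P_def Hx)
  have "H = UNIV"
  proof (rule ccontr)
    assume "H \<noteq> UNIV"
    then obtain a where a: "a \<notin> H" by auto
    obtain H' \<psi>' where e: "partial_character H' \<psi>'" "H \<subseteq> H'" "a \<in> H'"
      "\<And>x. x \<in> H \<Longrightarrow> \<psi>' x = \<psi> x"
      using extend_partial_character[OF H(1) a] by metis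
    then have "P (H', \<psi>')" using H by (auto simp: P_def)
    then have "card H' \<le> card H" using max Hx by force
    moreover have "card H < card H'" by (rule psubset_card_mono) (use e a in auto)
    ultimately show False by simp
  qed
  then have "\<psi> \<in> characters" using H by (auto simp: partial_character_def characters_def)
  then show thesis using H that by blast
qed

section \<open>Orthogonality of characters\<close>

lemma character_diff:
  assumes "\<xi> \<in> characters"
  shows "\<xi> (g - h) = \<xi> g / \<xi> h"
proof -
  have "\<xi> g = \<xi> (g - h) * \<xi> h"
    using assms unfolding characters_def by (metis (mono_tags, lifting) diff_add_cancel mem_Collect_eq)
  then show ?thesis using character_nonzero[OF assms] by simp
qed

lemma sum_character:
  fixes \<xi> :: "'g::{finite,ab_group_add} \<Rightarrow> complex"
  assumes "\<xi> \<in> characters" "\<xi> \<noteq> (\<lambda>_. 1)"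
  shows "(\<Sum>g\<in>UNIV. \<xi> g) = 0"
proof -
  obtain a where a: "\<xi> a \<noteq> 1" using assms(2) by auto
  have "(\<Sum>g\<in>UNIV. \<xi> g) = (\<Sum>g\<in>UNIV. \<xi> (a + g))"
    by (rule sum.reindex_bij_betw[symmetric]) (rule bij_plus)
  also have "\<dots> = \<xi> a * (\<Sum>g\<in>UNIV. \<xi> g)"
    using assms(1) by (simp add: characters_def sum_distrib_left)
  finally show ?thesis using a by simp
qed

lemma sum_characters_nonzero:
  fixes d :: "'g::{finite,ab_group_add}"
  assumes "d \<noteq> 0"
  shows "(\<Sum>\<xi>\<in>characters. \<xi> d) = 0"
proof -
  obtain \<eta> :: "'g \<Rightarrow> complex" where e: "\<eta> \<in> characters" "\<eta> d \<noteq> 1"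
    using characters_separate[OF assms] .
  let ?T = "\<lambda>\<xi> g. \<eta> g * \<xi> g"
  have "inj_on ?T characters"
    using character_nonzero[OF e(1)] by (auto simp: inj_on_def fun_eq_iff)
  moreover have "?T ` characters \<subseteq> characters"
    using e(1) by (auto simp: characters_def norm_mult)
  ultimately have "bij_betw ?T characters characters"
    using endo_inj_surj[OF finite_characters] by (simp add: bij_betw_def)
  then have "(\<Sum>\<xi>\<in>characters. \<xi> d) = (\<Sum>\<xi>\<in>characters. ?T \<xi> d)"
    by (rule sum.reindex_bij_betw[symmetric])
  also have "\<dots> = \<eta> d * (\<Sum>\<xi>\<in>characters. \<xi> d)" by (simp add: sum_distrib_left)
  finally show ?thesis using e(2) by simp
qed

text \<open>
  At \<open>d = 0\<close> the sum is the number of characters. Summing \<open>\<xi> g\<close> over all pairs, only \<open>g = 0\<close>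
  contributes in one order and only the trivial character in the other, so this number is the
  order of the group.
\<close>

lemma sum_characters:
  fixes d :: "'g::{finite,ab_group_add}"
  shows "(\<Sum>\<xi>\<in>characters. \<xi> d) = (if d = 0 then of_nat CARD('g) else 0)"
proof (cases "d = 0")
  case True
  have trivial: "(\<lambda>_::'g. 1) \<in> characters" by (simp add: characters_def)
  have "(\<Sum>\<xi>\<in>characters. \<xi> d) = (\<Sum>g\<in>UNIV. if g = (0::'g) then \<Sum>\<xi>\<in>characters. \<xi> g else 0)"
    by (simp add: True)
  also have "\<dots> = (\<Sum>g\<in>UNIV. \<Sum>\<xi>\<in>characters. \<xi> (g::'g))"
    by (rule sum.cong) (auto simp: sum_characters_nonzero)
  also have "\<dots> = (\<Sum>\<xi>\<in>characters. \<Sum>g\<in>UNIV. \<xi> (g::'g))"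
    by (rule sum.swap)
  also have "\<dots> = (\<Sum>\<xi>\<in>characters. if \<xi> = (\<lambda>_::'g. 1) then of_nat CARD('g) else 0)"
    by (rule sum.cong) (auto simp: sum_character)
  also have "\<dots> = of_nat CARD('g)"
    using trivial by (simp add: sum.delta finite_characters)
  finally show ?thesis using True by simp
qed (simp add: sum_characters_nonzero)

section \<open>The frame operator of the whole phase space\<close>

lemma inv_tf_shift:
  fixes x :: "complex ^ 'g::{finite,ab_group_add}"
  assumes "\<xi> \<in> characters"
  shows "inv_into UNIV (tf_shift (k, \<xi>)) x = (\<chi> h. x $ (h + k) / \<xi> (h + k))"
proof (rule inv_f_eq)
  show "inj (tf_shift (k, \<xi>))" using bij_tf_shift[OF assms] by (rule bij_is_inj)
  show "tf_shift (k, \<xi>) (\<chi> h. x $ (h + k) / \<xi> (h + k)) = x"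
    using character_nonzero[OF assms] by (simp add: vec_eq_iff)
qed

lemma linear_functional_coordinates:
  fixes f :: "complex ^ 'n \<Rightarrow> complex"
  assumes "Vector_Spaces.linear (*s) (*) f"
  shows "f y = (\<Sum>h\<in>UNIV. f (axis h 1) * y $ h)"
proof -
  interpret f: Vector_Spaces.linear "(*s)" "(*)" f by (rule assms)
  have "f y = f (\<Sum>h\<in>UNIV. y $ h *s axis h 1)" by (simp add: basis_expansion)
  also have "\<dots> = (\<Sum>h\<in>UNIV. f (axis h 1) * y $ h)"
    by (simp add: f.sum f.scale mult.commute)
  finally show ?thesis .
qed

lemma gabor_operator_phase_space:
  fixes f :: "complex ^ 'g::{finite,ab_group_add} \<Rightarrow> complex"
  assumes "Vector_Spaces.linear (*s) (*) f"
  shows "gabor_operator f \<tau> (UNIV \<times> characters) x = (of_nat CARD('g) * f \<tau>) *s x"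
proof (subst vec_eq_iff, intro allI)
  fix g :: 'g
  define c where "c h = f (axis h 1)" for h
  have f: "f y = (\<Sum>h\<in>UNIV. c h * y $ h)" for y
    unfolding c_def by (rule linear_functional_coordinates[OF assms])
  have "gabor_operator f \<tau> (UNIV \<times> characters) x $ g
      = (\<Sum>(k, \<xi>)\<in>UNIV \<times> characters.
           f (inv_into UNIV (tf_shift (k, \<xi>)) x) * (\<xi> g * \<tau> $ (g - k)))"
    by (auto simp: gabor_operator_def intro!: sum.cong)
  also have "\<dots> = (\<Sum>k\<in>UNIV. \<Sum>\<xi>\<in>characters.
           f (inv_into UNIV (tf_shift (k, \<xi>)) x) * (\<xi> g * \<tau> $ (g - k)))"
    by (rule sum.cartesian_product[symmetric])
  also have "\<dots> = (\<Sum>k\<in>UNIV. \<Sum>\<xi>\<in>characters. \<Sum>h\<in>UNIV.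
           c h * x $ (h + k) * \<tau> $ (g - k) * \<xi> (g - (h + k)))"
    by (intro sum.cong refl)
       (simp add: inv_tf_shift f character_diff sum_distrib_right sum_distrib_left mult_ac)
  also have "\<dots> = (\<Sum>k\<in>UNIV. \<Sum>h\<in>UNIV. \<Sum>\<xi>\<in>characters.
           c h * x $ (h + k) * \<tau> $ (g - k) * \<xi> (g - (h + k)))"
    by (intro sum.cong refl sum.swap)
  also have "\<dots> = (\<Sum>k\<in>UNIV. \<Sum>h\<in>UNIV.
           c h * x $ (h + k) * \<tau> $ (g - k) * (if g - (h + k) = 0 then of_nat CARD('g) else 0))"
    by (simp only: sum_characters flip: sum_distrib_left)
  also have "\<dots> = (\<Sum>k\<in>UNIV. \<Sum>h\<in>UNIV.
           if h = g - k then of_nat CARD('g) * x $ g * (c h * \<tau> $ h) else 0)"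
    by (intro sum.cong refl) (auto simp: algebra_simps)
  also have "\<dots> = (\<Sum>k\<in>UNIV. of_nat CARD('g) * x $ g * (c (g - k) * \<tau> $ (g - k)))"
    by simp
  also have "\<dots> = (\<Sum>h\<in>UNIV. of_nat CARD('g) * x $ g * (c h * \<tau> $ h))"
    by (rule sum.reindex_bij_witness[of _ "\<lambda>h. g - h" "\<lambda>k. g - k"]) auto
  also have "\<dots> = ((of_nat CARD('g) * f \<tau>) *s x) $ g"
    by (simp add: f sum_distrib_left sum_distrib_right mult_ac)
  finally show "gabor_operator f \<tau> (UNIV \<times> characters) x $ g
      = ((of_nat CARD('g) * f \<tau>) *s x) $ g" .
qed

lemma invertible_operator_scalar:
  fixes c :: complex
  assumes "c \<noteq> 0"
  shows "invertible_operator (\<lambda>x :: complex ^ 'n. c *s x)"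
proof -
  have linear: "Vector_Spaces.linear (*s) (*s) (\<lambda>x :: complex ^ 'n. b *s x)" for b
    by unfold_locales (simp_all add: vec_eq_iff algebra_simps)
  show ?thesis
    unfolding invertible_operator_def
    by (intro conjI exI[of _ "\<lambda>x. (1 / c) *s x"] linear) (auto simp: fun_eq_iff assms)
qed

theorem corollary3p4:
  fixes f :: "complex ^ 'g::{finite,ab_group_add} \<Rightarrow> complex" and \<tau> :: "complex ^ 'g::{finite,ab_group_add}"
  assumes "Vector_Spaces.linear (*s) (*) f"
    and "f \<tau> \<noteq> 0"
  shows "(\<forall>x. x = (1 / (of_nat CARD('g) * f \<tau>)) *s
            (\<Sum>\<mu>\<in>UNIV \<times> characters. f (inv_into UNIV (tf_shift \<mu>) x) *s tf_shift \<mu> \<tau>))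
       \<and> gabor_schauder_frame f \<tau> (UNIV \<times> characters)"
proof
  note S = gabor_operator_phase_space[OF assms(1), of \<tau>]
  have nz: "of_nat CARD('g) * f \<tau> \<noteq> 0" using assms(2) by simp
  show "\<forall>x. x = (1 / (of_nat CARD('g) * f \<tau>)) *s
            (\<Sum>\<mu>\<in>UNIV \<times> characters. f (inv_into UNIV (tf_shift \<mu>) x) *s tf_shift \<mu> \<tau>)"
    using nz by (simp add: S[unfolded gabor_operator_def])
  have "subgroup (UNIV \<times> characters) (phase_space :: ('g \<times> ('g \<Rightarrow> complex)) monoid)"
    using group.subgroup_self[OF group_phase_space] by (simp add: carrier_phase_space)
  moreover have "\<tau> \<noteq> 0"
    using assms linear_functional_coordinates[OF assms(1), of \<tau>] by auto
  moreover have "invertible_operator (gabor_operator f \<tau> (UNIV \<times> characters))"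
    using invertible_operator_scalar[OF nz] by (simp add: S[THEN ext])
  ultimately show "gabor_schauder_frame f \<tau> (UNIV \<times> characters)"
    using assms unfolding gabor_schauder_frame_def by auto
qed

end
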